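(* Let $a_1,a_2,a_3$ be non-null points which are collinear (they lie on a common line), and let $q_1\equiv q(a_2,a_3)$, $q_2\equiv q(a_1,a_3)$, $q_3\equiv q(a_1,a_2)$ be their quadrances. Then $$(q_1+q_2+q_3)^2=2(q_1^2+q_2^2+q_3^2)+4q_1q_2q_3.$$
   Context: Let $\mathbb F$ be a field of characteristic not two. A 3-proportion $x:y:z$ is a triple of elements of $\mathbb F$, not all zero, up to a common non-zero scalar. A point $a=[x:y:z]$ and a line $L=(l:m:n)$ are both 3-proportions. The point $[x:y:z]$ lies on the line $(l:m:n)$ when $lx+my-nz=0$. A point $[x:y:z]$ is null when $x^2+y^2-z^2=0$. The quadrance between non-null points $a_1=[x_1:y_1:z_1]$ and $a_2=[x_2:y_2:z_2]$ is $$q(a_1,a_2)=1-\frac{(x_1x_2+y_1y_2-z_1z_2)^2}{(x_1^2+y_1^2-z_1^2)(x_2^2+y_2^2-z_2^2)};$$ it is undefined if either point is null. *)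

theory Defs
  imports Complex_Main
begin

fun proportional :: "'a::field \<times> 'a \<times> 'a \<Rightarrow> 'a \<times> 'a \<times> 'a \<Rightarrow> bool" where
  "proportional (x, y, z) (x', y', z') \<longleftrightarrow>
     (x, y, z) \<noteq> (0, 0, 0) \<and> (x', y', z') \<noteq> (0, 0, 0) \<and>
     (\<exists>c. c \<noteq> 0 \<and> x' = c * x \<and> y' = c * y \<and> z' = c * z)"

text \<open>The zero triple is related to nothing, not even to itself, so the quotient below is
  taken over the non-zero triples only.\<close>

quotient_type (overloaded) 'a proportion = "'a::field \<times> 'a \<times> 'a" / partial: proportional
proof (rule part_equivpI)
  show "\<exists>v::'a \<times> 'a \<times> 'a. proportional v v"
  proof
    show "proportional (1, 0, 0) (1, 0, 0 :: 'a)"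
      by (auto intro!: exI[of _ 1])
  qed
  show "symp (proportional :: 'a \<times> 'a \<times> 'a \<Rightarrow> _)"
  proof (rule sympI)
    fix u v :: "'a \<times> 'a \<times> 'a"
    assume uv: "proportional u v"
    obtain x y z x' y' z' where [simp]: "u = (x, y, z)" "v = (x', y', z')"
      by (metis prod_cases3)
    from uv obtain c where "c \<noteq> 0" "x' = c * x" "y' = c * y" "z' = c * z" by auto
    with uv show "proportional v u"
      by (auto intro!: exI[of _ "inverse c"])
  qed
  show "transp (proportional :: 'a \<times> 'a \<times> 'a \<Rightarrow> _)"
  proof (rule transpI)
    fix u v w :: "'a \<times> 'a \<times> 'a"
    assume uv: "proportional u v" and vw: "proportional v w"
    obtain x y z x' y' z' x'' y'' z''
      where [simp]: "u = (x, y, z)" "v = (x', y', z')" "w = (x'', y'', z'')"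
      by (metis prod_cases3)
    from uv obtain c where c: "c \<noteq> 0" "x' = c * x" "y' = c * y" "z' = c * z" by auto
    from vw obtain d where d: "d \<noteq> 0" "x'' = d * x'" "y'' = d * y'" "z'' = d * z'" by auto
    have "\<exists>e. e \<noteq> 0 \<and> x'' = e * x \<and> y'' = e * y \<and> z'' = e * z"
      using c d by (intro exI[of _ "d * c"]) simp
    with uv vw show "proportional u w" by simp
  qed
qed

type_synonym 'a point = "'a proportion"
type_synonym 'a line = "'a proportion"

lift_definition lies_on :: "'a::field point \<Rightarrow> 'a line \<Rightarrow> bool"
  is "\<lambda>(x, y, z) (l, m, n). l * x + m * y - n * z = 0"
proof -
  fix u v s t :: "'a \<times> 'a \<times> 'a"
  assume uv: "proportional u v" and st: "proportional s t"
  obtain x y z x' y' z' l m n l' m' n'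
    where e [simp]: "u = (x, y, z)" "v = (x', y', z')" "s = (l, m, n)" "t = (l', m', n')"
    by (metis prod_cases3)
  from uv obtain c where c: "c \<noteq> 0" "x' = c * x" "y' = c * y" "z' = c * z" by auto
  from st obtain d where d: "d \<noteq> 0" "l' = d * l" "m' = d * m" "n' = d * n" by auto
  have "l' * x' + m' * y' - n' * z' = (d * c) * (l * x + m * y - n * z)"
    using c d by (simp add: algebra_simps)
  with c(1) d(1) have "l' * x' + m' * y' - n' * z' = 0 \<longleftrightarrow> l * x + m * y - n * z = 0"
    by (simp only: mult_eq_0_iff) simp
  then show "(case u of (x, y, z) \<Rightarrow> \<lambda>(l, m, n). l * x + m * y - n * z = 0) s =
             (case v of (x, y, z) \<Rightarrow> \<lambda>(l, m, n). l * x + m * y - n * z = 0) t"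
    by (simp only: e prod.case)
qed

definition collinear3 :: "'a::field point \<Rightarrow> 'a point \<Rightarrow> 'a point \<Rightarrow> bool" where
  "collinear3 a b c \<longleftrightarrow> (\<exists>L. lies_on a L \<and> lies_on b L \<and> lies_on c L)"

fun form :: "'a::field \<times> 'a \<times> 'a \<Rightarrow> 'a \<times> 'a \<times> 'a \<Rightarrow> 'a" where
  "form (x\<^sub>1, y\<^sub>1, z\<^sub>1) (x\<^sub>2, y\<^sub>2, z\<^sub>2) = x\<^sub>1 * x\<^sub>2 + y\<^sub>1 * y\<^sub>2 - z\<^sub>1 * z\<^sub>2"

lemma proportional_form:
  assumes "proportional u v"
  obtains c where "c \<noteq> 0" "\<And>w. form v w = c * form u w" "\<And>w. form w v = c * form w u"
proof -
  obtain x y z x' y' z' where e [simp]: "u = (x, y, z)" "v = (x', y', z')"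
    by (metis prod_cases3)
  from assms obtain c where c: "c \<noteq> 0" "x' = c * x" "y' = c * y" "z' = c * z" by auto
  show thesis
  proof (rule that[OF c(1)])
    fix w :: "'a \<times> 'a \<times> 'a"
    obtain a b d where [simp]: "w = (a, b, d)" by (metis prod_cases3)
    show "form v w = c * form u w" "form w v = c * form w u"
      using c by (simp_all add: algebra_simps)
  qed
qed

lift_definition null_point :: "'a::field point \<Rightarrow> bool"
  is "\<lambda>(x, y, z). x\<^sup>2 + y\<^sup>2 - z\<^sup>2 = 0"
proof -
  fix u v :: "'a \<times> 'a \<times> 'a"
  assume uv: "proportional u v"
  obtain x y z x' y' z' where e [simp]: "u = (x, y, z)" "v = (x', y', z')"
    by (metis prod_cases3)
  from proportional_form[OF uv] obtain c
    where c: "c \<noteq> 0" "\<And>w. form v w = c * form u w" "\<And>w. form w v = c * form w u" by metis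
  have "form v v = c * (c * form u u)" by (simp only: c)
  with c(1) have "form v v = 0 \<longleftrightarrow> form u u = 0" by simp
  then show "(case u of (x, y, z) \<Rightarrow> x\<^sup>2 + y\<^sup>2 - z\<^sup>2 = 0) =
             (case v of (x, y, z) \<Rightarrow> x\<^sup>2 + y\<^sup>2 - z\<^sup>2 = 0)"
    by (simp add: power2_eq_square)
qed

text \<open>When one of the points is null the quadrance has no mathematical meaning; \<open>undefined\<close>
  is then an arbitrary field element.\<close>

lift_definition quadrance :: "'a::field point \<Rightarrow> 'a point \<Rightarrow> 'a"
  is "\<lambda>(x\<^sub>1, y\<^sub>1, z\<^sub>1) (x\<^sub>2, y\<^sub>2, z\<^sub>2).
        if x\<^sub>1\<^sup>2 + y\<^sub>1\<^sup>2 - z\<^sub>1\<^sup>2 = 0 \<or> x\<^sub>2\<^sup>2 + y\<^sub>2\<^sup>2 - z\<^sub>2\<^sup>2 = 0 then undefined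
        else 1 - (x\<^sub>1 * x\<^sub>2 + y\<^sub>1 * y\<^sub>2 - z\<^sub>1 * z\<^sub>2)\<^sup>2 /
                 ((x\<^sub>1\<^sup>2 + y\<^sub>1\<^sup>2 - z\<^sub>1\<^sup>2) * (x\<^sub>2\<^sup>2 + y\<^sub>2\<^sup>2 - z\<^sub>2\<^sup>2))"
proof -
  fix u v s t :: "'a \<times> 'a \<times> 'a"
  assume uv: "proportional u v" and st: "proportional s t"
  define Q where "Q = (\<lambda>u s :: 'a \<times> 'a \<times> 'a. if form u u = 0 \<or> form s s = 0 then undefined
    else 1 - (form u s)\<^sup>2 / (form u u * form s s))"
  have Q: "(case u of (x\<^sub>1, y\<^sub>1, z\<^sub>1) \<Rightarrow> \<lambda>(x\<^sub>2, y\<^sub>2, z\<^sub>2).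
        if x\<^sub>1\<^sup>2 + y\<^sub>1\<^sup>2 - z\<^sub>1\<^sup>2 = 0 \<or> x\<^sub>2\<^sup>2 + y\<^sub>2\<^sup>2 - z\<^sub>2\<^sup>2 = 0 then undefined
        else 1 - (x\<^sub>1 * x\<^sub>2 + y\<^sub>1 * y\<^sub>2 - z\<^sub>1 * z\<^sub>2)\<^sup>2 /
                 ((x\<^sub>1\<^sup>2 + y\<^sub>1\<^sup>2 - z\<^sub>1\<^sup>2) * (x\<^sub>2\<^sup>2 + y\<^sub>2\<^sup>2 - z\<^sub>2\<^sup>2))) s = Q u s" for u s
    by (cases u; cases s) (simp add: Q_def power2_eq_square)
  from proportional_form[OF uv] obtain c
    where c: "c \<noteq> 0" "\<And>w. form v w = c * form u w" "\<And>w. form w v = c * form w u" by metis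
  from proportional_form[OF st] obtain d
    where d: "d \<noteq> 0" "\<And>w. form t w = d * form s w" "\<And>w. form w t = d * form w s" by metis
  have "(c * (d * form u s))\<^sup>2 / (c * (c * form u u) * (d * (d * form s s))) =
        (c\<^sup>2 * d\<^sup>2) * (form u s)\<^sup>2 / ((c\<^sup>2 * d\<^sup>2) * (form u u * form s s))"
    by (simp add: power2_eq_square mult_ac)
  also have "\<dots> = (form u s)\<^sup>2 / (form u u * form s s)"
    using c(1) d(1) by (intro nonzero_mult_divide_mult_cancel_left) simp
  finally have "Q u s = Q v t"
    using c(1) d(1) by (simp add: Q_def c(2,3) d(2,3) mult_ac)
  then show "(case u of (x\<^sub>1, y\<^sub>1, z\<^sub>1) \<Rightarrow> \<lambda>(x\<^sub>2, y\<^sub>2, z\<^sub>2).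
        if x\<^sub>1\<^sup>2 + y\<^sub>1\<^sup>2 - z\<^sub>1\<^sup>2 = 0 \<or> x\<^sub>2\<^sup>2 + y\<^sub>2\<^sup>2 - z\<^sub>2\<^sup>2 = 0 then undefined
        else 1 - (x\<^sub>1 * x\<^sub>2 + y\<^sub>1 * y\<^sub>2 - z\<^sub>1 * z\<^sub>2)\<^sup>2 /
                 ((x\<^sub>1\<^sup>2 + y\<^sub>1\<^sup>2 - z\<^sub>1\<^sup>2) * (x\<^sub>2\<^sup>2 + y\<^sub>2\<^sup>2 - z\<^sub>2\<^sup>2))) s =
      (case v of (x\<^sub>1, y\<^sub>1, z\<^sub>1) \<Rightarrow> \<lambda>(x\<^sub>2, y\<^sub>2, z\<^sub>2).
        if x\<^sub>1\<^sup>2 + y\<^sub>1\<^sup>2 - z\<^sub>1\<^sup>2 = 0 \<or> x\<^sub>2\<^sup>2 + y\<^sub>2\<^sup>2 - z\<^sub>2\<^sup>2 = 0 then undefined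
        else 1 - (x\<^sub>1 * x\<^sub>2 + y\<^sub>1 * y\<^sub>2 - z\<^sub>1 * z\<^sub>2)\<^sup>2 /
                 ((x\<^sub>1\<^sup>2 + y\<^sub>1\<^sup>2 - z\<^sub>1\<^sup>2) * (x\<^sub>2\<^sup>2 + y\<^sub>2\<^sup>2 - z\<^sub>2\<^sup>2))) t"
    by (simp only: Q)
qed

end

theory Submission
  imports Defs
begin

text \<open>Incidence is orthogonality for the form, so collinear points have three dependent
  representatives and their Gram determinant vanishes. Dividing it by the product of the three
  norms and putting \<open>p\<^sub>i = 1 - q\<^sub>i\<close> gives \<open>p\<^sub>1 + p\<^sub>2 + p\<^sub>3 - 1 = 2 t\<close> with
  \<open>t\<^sup>2 = p\<^sub>1 p\<^sub>2 p\<^sub>3\<close>; squaring yields the formula.\<close>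

text \<open>The two sides differ by the Gram determinant of \<open>u\<close>, \<open>v\<close>,
  \<open>w\<close>. The form has determinant -1, so this equals \<open>- D^2\<close>, where
  \<open>D\<close> is the determinant with rows \<open>u\<close>, \<open>v\<close>,
  \<open>w\<close>.\<close>

lemma gram_det_eq_0:
  fixes u v w k :: "'a::field \<times> 'a \<times> 'a"
  assumes "k \<noteq> (0, 0, 0)" "form k u = 0" "form k v = 0" "form k w = 0"
  shows "form u u * form v v * form w w + 2 * form v w * form u w * form u v
    = form u u * (form v w)\<^sup>2 + form v v * (form u w)\<^sup>2 + form w w * (form u v)\<^sup>2"
proof -
  obtain l m n x\<^sub>1 y\<^sub>1 z\<^sub>1 x\<^sub>2 y\<^sub>2 z\<^sub>2 x\<^sub>3 y\<^sub>3 z\<^sub>3 where [simp]: "k = (l, m, n)"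
      "u = (x\<^sub>1, y\<^sub>1, z\<^sub>1)" "v = (x\<^sub>2, y\<^sub>2, z\<^sub>2)" "w = (x\<^sub>3, y\<^sub>3, z\<^sub>3)"
    by (metis prod_cases3)
  define D where "D = x\<^sub>1 * (y\<^sub>2 * z\<^sub>3 - y\<^sub>3 * z\<^sub>2) - y\<^sub>1 * (x\<^sub>2 * z\<^sub>3 - x\<^sub>3 * z\<^sub>2) + z\<^sub>1 * (x\<^sub>2 * y\<^sub>3 - x\<^sub>3 * y\<^sub>2)"
  have k: "l * x\<^sub>1 + m * y\<^sub>1 - n * z\<^sub>1 = 0" "l * x\<^sub>2 + m * y\<^sub>2 - n * z\<^sub>2 = 0"
    "l * x\<^sub>3 + m * y\<^sub>3 - n * z\<^sub>3 = 0"
    using assms by simp_all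
  \<comment> \<open>Cramer's rule: the vector \<open>(l, m, -n)\<close> is in the kernel of the
    matrix with rows \<open>u\<close>, \<open>v\<close>, \<open>w\<close>, so the adjugate shows
    that \<open>D\<close> annihilates each coordinate.\<close>
  have "l * D = 0" "m * D = 0" "n * D = 0"
    unfolding D_def using k by algebra+
  then have "D = 0"
    using assms(1) by auto
  then show ?thesis
    unfolding D_def by simp algebra
qed

text \<open>The purely algebraic half: \<open>A\<close>, \<open>B\<close>, \<open>C\<close> are the
  diagonal entries of the Gram matrix and \<open>p\<close>, \<open>q\<close>, \<open>r\<close> its
  entries at (2,3), (1,3), (1,2).\<close>

lemma triple_quad_formula_of_gram:
  fixes A B C p q r :: "'a::field"
  assumes nz: "A \<noteq> 0" "B \<noteq> 0" "C \<noteq> 0"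
    and gram: "A * B * C + 2 * p * q * r = A * p\<^sup>2 + B * q\<^sup>2 + C * r\<^sup>2"
    and q: "q\<^sub>1 = 1 - p\<^sup>2 / (B * C)" "q\<^sub>2 = 1 - q\<^sup>2 / (A * C)" "q\<^sub>3 = 1 - r\<^sup>2 / (A * B)"
  shows "(q\<^sub>1 + q\<^sub>2 + q\<^sub>3)\<^sup>2 = 2 * (q\<^sub>1\<^sup>2 + q\<^sub>2\<^sup>2 + q\<^sub>3\<^sup>2) + 4 * q\<^sub>1 * q\<^sub>2 * q\<^sub>3"
proof -
  define t where "t = p * q * r / (A * B * C)"
  \<comment> \<open>Each norm occurs in exactly two of the three denominators, so their product is a
    square.\<close>
  have "t\<^sup>2 = (1 - q\<^sub>1) * (1 - q\<^sub>2) * (1 - q\<^sub>3)"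
    using nz by (simp add: q t_def field_simps power2_eq_square)
  moreover have "2 * t = 2 - q\<^sub>1 - q\<^sub>2 - q\<^sub>3"
  proof -
    have "2 * t = (A * p\<^sup>2 + B * q\<^sup>2 + C * r\<^sup>2 - A * B * C) / (A * B * C)"
      using gram by (simp add: t_def eq_diff_eq add.commute mult.assoc)
    also have "\<dots> = p\<^sup>2 / (B * C) + q\<^sup>2 / (A * C) + r\<^sup>2 / (A * B) - 1"
      using nz by (simp add: add_divide_distrib diff_divide_distrib mult.commute)
    finally show ?thesis
      by (simp add: q)
  qed
  \<comment> \<open>With \<open>s\<close> the sum, \<open>e2\<close> and \<open>e3\<close> the
    higher elementary symmetric functions of the quadrances, eliminating \<open>t\<close> gives
    \<open>(2 - s)^2 = 4 * (1 - s + e2 - e3)\<close>, so \<open>s^2 = 4 * e2 - 4 * e3\<close>; then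
    \<open>2 * e2\<close> is \<open>s^2\<close> minus the sum of squares.\<close>
  ultimately show ?thesis
    by algebra
qed

text \<open>Descends to representatives. The Gram entries depend on their choice, hence the
  existential quantifiers; the quadrances do not.\<close>

lemma collinear3_gram:
  fixes a b c :: "'a::field point"
  assumes "collinear3 a b c" "\<not> null_point a" "\<not> null_point b" "\<not> null_point c"
  shows "\<exists>A B C p q r. A \<noteq> 0 \<and> B \<noteq> 0 \<and> C \<noteq> 0 \<and>
    A * B * C + 2 * p * q * r = A * p\<^sup>2 + B * q\<^sup>2 + C * r\<^sup>2 \<and>
    quadrance b c = 1 - p\<^sup>2 / (B * C) \<and> quadrance a c = 1 - q\<^sup>2 / (A * C) \<and>
    quadrance a b = 1 - r\<^sup>2 / (A * B)"
  using assms unfolding collinear3_def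
proof (transfer, clarify, goal_cases)
  case (1 x\<^sub>1 y\<^sub>1 z\<^sub>1 x\<^sub>2 y\<^sub>2 z\<^sub>2 x\<^sub>3 y\<^sub>3 z\<^sub>3 l m n)
  let ?u = "(x\<^sub>1, y\<^sub>1, z\<^sub>1)" and ?v = "(x\<^sub>2, y\<^sub>2, z\<^sub>2)" and ?w = "(x\<^sub>3, y\<^sub>3, z\<^sub>3)"
  \<comment> \<open>The common line serves as \<open>k\<close>; it is non-zero because
    \<open>proportional\<close> excludes the zero triple.\<close>
  have "form ?u ?u * form ?v ?v * form ?w ?w + 2 * form ?v ?w * form ?u ?w * form ?u ?v
      = form ?u ?u * (form ?v ?w)\<^sup>2 + form ?v ?v * (form ?u ?w)\<^sup>2 + form ?w ?w * (form ?u ?v)\<^sup>2"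
    using 1 by (intro gram_det_eq_0[of "(l, m, n)"]) simp_all
  moreover have "form ?u ?u \<noteq> 0" "form ?v ?v \<noteq> 0" "form ?w ?w \<noteq> 0"
    using 1 by (simp_all add: power2_eq_square)
  ultimately show ?case
    using 1
    by (rule_tac exI[of _ "form ?u ?u"], rule_tac exI[of _ "form ?v ?v"],
        rule_tac exI[of _ "form ?w ?w"], rule_tac exI[of _ "form ?v ?w"],
        rule_tac exI[of _ "form ?u ?w"], rule_tac exI[of _ "form ?u ?v"])
      (simp add: power2_eq_square del: proportional.simps)
qed

theorem theorem38:
  fixes a\<^sub>1 a\<^sub>2 a\<^sub>3 :: "'a::field point" and q\<^sub>1 q\<^sub>2 q\<^sub>3 :: 'a
  assumes "CHAR('a) \<noteq> 2"
    and "\<not> null_point a\<^sub>1" and "\<not> null_point a\<^sub>2" and "\<not> null_point a\<^sub>3"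
    and "collinear3 a\<^sub>1 a\<^sub>2 a\<^sub>3"
    and "q\<^sub>1 = quadrance a\<^sub>2 a\<^sub>3" and "q\<^sub>2 = quadrance a\<^sub>1 a\<^sub>3" and "q\<^sub>3 = quadrance a\<^sub>1 a\<^sub>2"
  shows "(q\<^sub>1 + q\<^sub>2 + q\<^sub>3)\<^sup>2 = 2 * (q\<^sub>1\<^sup>2 + q\<^sub>2\<^sup>2 + q\<^sub>3\<^sup>2) + 4 * q\<^sub>1 * q\<^sub>2 * q\<^sub>3"
  using collinear3_gram[OF assms(5,2-4)] unfolding assms(6-8)
  by (elim exE conjE) (rule triple_quad_formula_of_gram)

end
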